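(* For every $n\ge1$, $\alpha_n(x)=\sum_{k=0}^{\lfloor n/2\rfloor}E_{2k}\binom{n}{2k}x^{n-2k}$, where $\alpha_n$ are the polynomials associated with $\mathfrak{gl}(1|2)\supset\mathfrak{osp}(1|2)$ defined in the context and $E_{2k}=(-1)^kA_{2k}$ with $\tan(x)+\sec(x)=\sum_{n\ge0}\frac{A_n}{n!}x^n$.
   Context: The base field is $\mathbb C$. $\mathfrak g=\mathfrak{gl}(1|2)$ is the Lie superalgebra of $3\times3$ complex matrices, whose first row/column index is even and whose second and third indices are odd, with supercommutator bracket. $E_{i,j}$ (two indices) are the matrix units, not to be confused with the numbers $E_{2k}$. Let $p=2E_{1,1}+E_{2,2}+E_{3,3}$, and for $v=(a,b)\in\mathbb C^2$ let $v_{\mathfrak p}:=\begin{bmatrix} 0 & a & b \\ b & 0 & 0 \\ -a & 0 & 0 \end{bmatrix}$ and $v_{\mathfrak k}:=\begin{bmatrix} 0 & a & b \\ -b & 0 & 0 \\ a & 0 & 0 \end{bmatrix}$. Then $[v_{\mathfrak p},p]=-v_{\mathfrak k}$ and $[v_{\mathfrak k},p]=-v_{\mathfrak p}$. For $n\ge0$, $\alpha_n(x)$ and $\beta_{n-1}(x)$ (with $\beta_{-1}=0$) are the unique polynomials, independent of $v$, such that in $U(\mathfrak g)$ one has $p^nv_{\mathfrak k}=v_{\mathfrak k}\alpha_n(p)+\beta_{n-1}(p)v_{\mathfrak p}$ for all $v\in\mathbb C^2$. The numbers $E_{2k}$ are equivalently given by $\mathrm{sech}(x)=\sum_{k\ge0}\frac{E_{2k}}{(2k)!}x^{2k}$.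 *)

theory Defs
  imports
    "HOL-Analysis.Analysis"
    "HOL-Library.Poly_Mapping"
    "HOL-Computational_Algebra.Computational_Algebra"
begin

type_synonym gl12 = "complex ^ 3 ^ 3"

definition index_parity :: "3 \<Rightarrow> nat" where
  "index_parity i = (if i = 1 then 0 else 1)"

definition gl_part :: "nat \<Rightarrow> gl12 \<Rightarrow> gl12" where
  "gl_part d X = (\<chi> i j. if (index_parity i + index_parity j) mod 2 = d then X $ i $ j else 0)"

definition gl_homogeneous :: "nat \<Rightarrow> gl12 \<Rightarrow> bool" where
  "gl_homogeneous d X \<longleftrightarrow> d \<in> {0, 1} \<and> gl_part d X = X"

definition gl_scale :: "complex \<Rightarrow> gl12 \<Rightarrow> gl12" where
  "gl_scale c X = (\<chi> i j. c * X $ i $ j)"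

definition superbracket :: "gl12 \<Rightarrow> gl12 \<Rightarrow> gl12" where
  "superbracket X Y =
     (\<Sum>d\<in>{0, 1}. \<Sum>e\<in>{0, 1}.
        gl_part d X ** gl_part e Y - gl_scale ((-1) ^ (d * e)) (gl_part e Y ** gl_part d X))"

text \<open>
  The algebra \<open>U(gl(1|2))\<close> is presented as the free unital associative algebra on the underlying
  set of \<open>gl(1|2)\<close>, modulo the two-sided ideal generated by the linearity relations (which alone
  would give the tensor algebra) and the supercommutator relations.
  Elements of the free algebra are finitely supported functions on words; the product of
  \<^typ>\<open>'a \<Rightarrow>\<^sub>0 'b\<close> is convolution along the addition of \<^typ>\<open>'a\<close>,
  so concatenation of words is written additively.
\<close>

datatype 'a free_word = Free_Word "'a list"

instantiation free_word :: (type) monoid_add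
begin

definition zero_free_word :: "'a free_word" where
  "0 = Free_Word []"

fun plus_free_word :: "'a free_word \<Rightarrow> 'a free_word \<Rightarrow> 'a free_word" where
  "Free_Word u + Free_Word w = Free_Word (u @ w)"

instance
proof
  fix a b c :: "'a free_word"
  show "a + b + c = a + (b + c)" by (cases a; cases b; cases c) simp
  show "0 + a = a" by (cases a) (simp add: zero_free_word_def)
  show "a + 0 = a" by (cases a) (simp add: zero_free_word_def)
qed

end

lemma plus_free_word_eq_0_iff: "u + w = 0 \<longleftrightarrow> u = 0 \<and> w = 0" for u w :: "'a free_word"
  by (cases u; cases w) (simp add: zero_free_word_def)

type_synonym free_gl12 = "gl12 free_word \<Rightarrow>\<^sub>0 complex"

definition free_gen :: "gl12 \<Rightarrow> free_gl12" where
  "free_gen X = Poly_Mapping.single (Free_Word [X]) 1"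

definition free_scalar :: "complex \<Rightarrow> free_gl12" where
  "free_scalar c = Poly_Mapping.single 0 c"

definition enveloping_relations :: "free_gl12 set" where
  "enveloping_relations =
     {free_gen (X + Y) - free_gen X - free_gen Y | X Y. True} \<union>
     {free_gen (gl_scale c X) - free_scalar c * free_gen X | c X. True} \<union>
     {free_gen X * free_gen Y - (-1) ^ (d * e) * (free_gen Y * free_gen X)
        - free_gen (superbracket X Y) | X Y d e. gl_homogeneous d X \<and> gl_homogeneous e Y}"

inductive_set enveloping_ideal :: "free_gl12 set" where
  rel: "r \<in> enveloping_relations \<Longrightarrow> r \<in> enveloping_ideal"
| zero: "0 \<in> enveloping_ideal"
| add: "a \<in> enveloping_ideal \<Longrightarrow> b \<in> enveloping_ideal \<Longrightarrow> a + b \<in> enveloping_ideal"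
| lmult: "a \<in> enveloping_ideal \<Longrightarrow> x * a \<in> enveloping_ideal"
| rmult: "a \<in> enveloping_ideal \<Longrightarrow> a * x \<in> enveloping_ideal"

lemma enveloping_ideal_uminus: "a \<in> enveloping_ideal \<Longrightarrow> - a \<in> enveloping_ideal"
  using enveloping_ideal.lmult[of a "-1"] by simp

definition enveloping_cong :: "free_gl12 \<Rightarrow> free_gl12 \<Rightarrow> bool" where
  "enveloping_cong a b \<longleftrightarrow> a - b \<in> enveloping_ideal"

lemma equivp_enveloping_cong: "equivp enveloping_cong"
proof (rule equivpI)
  show "reflp enveloping_cong"
    by (auto simp: reflp_def enveloping_cong_def enveloping_ideal.zero)
  show "symp enveloping_cong"
    by (auto simp: symp_def enveloping_cong_def dest: enveloping_ideal_uminus)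
  show "transp enveloping_cong"
  proof (rule transpI)
    fix a b c assume "enveloping_cong a b" "enveloping_cong b c"
    then show "enveloping_cong a c"
      using enveloping_ideal.add[of "a - b" "b - c"] by (simp add: enveloping_cong_def)
  qed
qed

lemma lookup_mult_0:
  fixes f g :: "'a free_word \<Rightarrow>\<^sub>0 complex"
  shows "Poly_Mapping.lookup (f * g) 0 = Poly_Mapping.lookup f 0 * Poly_Mapping.lookup g 0"
proof -
  have "(\<Sum>q. Poly_Mapping.lookup g q when (0 :: 'a free_word) = l + q) =
      (Poly_Mapping.lookup g 0 when l = 0)" for l
  proof (cases "l = 0")
    case True
    then show ?thesis by (simp add: when_def)
  next
    case False
    then have "(0 :: 'a free_word) \<noteq> l + q" for q
      by (metis plus_free_word_eq_0_iff)
    then show ?thesis using False by simp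
  qed
  then show ?thesis
    by (simp add: lookup_mult mult_when)
qed

lemma enveloping_ideal_augmentation: "a \<in> enveloping_ideal \<Longrightarrow> Poly_Mapping.lookup a 0 = 0"
proof (induction rule: enveloping_ideal.induct)
  case (rel r)
  have "Poly_Mapping.lookup (free_gen X) 0 = 0" for X
    by (simp add: free_gen_def lookup_single zero_free_word_def)
  with rel show ?case
    by (auto simp: enveloping_relations_def lookup_minus lookup_mult_0)
qed (simp_all add: lookup_add lookup_mult_0)

lemma enveloping_not_cong_0_1: "\<not> enveloping_cong 0 1"
  using enveloping_ideal_augmentation[of "0 - 1"]
  by (auto simp: enveloping_cong_def lookup_minus)

quotient_type U_gl12 = free_gl12 / enveloping_cong
  by (rule equivp_enveloping_cong)

instantiation U_gl12 :: ring_1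
begin

lift_definition zero_U_gl12 :: U_gl12 is 0 .

lift_definition one_U_gl12 :: U_gl12 is 1 .

lift_definition plus_U_gl12 :: "U_gl12 \<Rightarrow> U_gl12 \<Rightarrow> U_gl12" is "(+)"
proof -
  fix a a' b b' assume "enveloping_cong a a'" "enveloping_cong b b'"
  then show "enveloping_cong (a + b) (a' + b')"
    using enveloping_ideal.add[of "a - a'" "b - b'"]
    by (simp add: enveloping_cong_def algebra_simps)
qed

lift_definition uminus_U_gl12 :: "U_gl12 \<Rightarrow> U_gl12" is uminus
proof -
  fix a a' assume "enveloping_cong a a'"
  then show "enveloping_cong (- a) (- a')"
    using enveloping_ideal_uminus[of "a - a'"]
    by (simp add: enveloping_cong_def algebra_simps)
qed

lift_definition minus_U_gl12 :: "U_gl12 \<Rightarrow> U_gl12 \<Rightarrow> U_gl12" is "(-)"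
proof -
  fix a a' b b' assume "enveloping_cong a a'" "enveloping_cong b b'"
  then show "enveloping_cong (a - b) (a' - b')"
    using enveloping_ideal.add[of "a - a'" "- (b - b')"] enveloping_ideal_uminus[of "b - b'"]
    by (simp add: enveloping_cong_def algebra_simps)
qed

lift_definition times_U_gl12 :: "U_gl12 \<Rightarrow> U_gl12 \<Rightarrow> U_gl12" is "(*)"
proof -
  fix a a' b b' assume *: "enveloping_cong a a'" "enveloping_cong b b'"
  have "a * b - a' * b' = (a - a') * b + a' * (b - b')"
    by (simp add: algebra_simps)
  with * show "enveloping_cong (a * b) (a' * b')"
    by (simp add: enveloping_cong_def
        enveloping_ideal.add enveloping_ideal.lmult enveloping_ideal.rmult)
qed

instance
proof
  have refl: "enveloping_cong a b" if "a = b" for a b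
    using that equivp_reflp[OF equivp_enveloping_cong] by simp
  fix a b c :: U_gl12
  show "a + b + c = a + (b + c)" by transfer (simp add: refl algebra_simps)
  show "a + b = b + a" by transfer (simp add: refl algebra_simps)
  show "0 + a = a" by transfer (simp add: refl)
  show "- a + a = 0" by transfer (simp add: refl)
  show "a - b = a + - b" by transfer (simp add: refl)
  show "a * b * c = a * (b * c)" by transfer (simp add: refl algebra_simps)
  show "1 * a = a" by transfer (simp add: refl)
  show "a * 1 = a" by transfer (simp add: refl)
  show "(a + b) * c = a * c + b * c" by transfer (simp add: refl algebra_simps)
  show "a * (b + c) = a * b + a * c" by transfer (simp add: refl algebra_simps)
  show "(0 :: U_gl12) \<noteq> 1" by transfer (rule enveloping_not_cong_0_1)
qed

end

lift_definition U_incl :: "gl12 \<Rightarrow> U_gl12" is free_gen .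

lift_definition U_scalar :: "complex \<Rightarrow> U_gl12" is free_scalar .

text \<open>
  The library's \<^const>\<open>poly\<close> only evaluates at points of the (commutative) coefficient ring.
\<close>

definition U_poly :: "complex poly \<Rightarrow> U_gl12 \<Rightarrow> U_gl12" where
  "U_poly q x = (\<Sum>i\<le>degree q. U_scalar (coeff q i) * x ^ i)"

definition p_elt :: gl12 where
  "p_elt = vector [vector [2, 0, 0], vector [0, 1, 0], vector [0, 0, 1]]"

definition v_p :: "complex \<times> complex \<Rightarrow> gl12" where
  "v_p = (\<lambda>(a, b). vector [vector [0, a, b], vector [b, 0, 0], vector [- a, 0, 0]])"

definition v_k :: "complex \<times> complex \<Rightarrow> gl12" where
  "v_k = (\<lambda>(a, b). vector [vector [0, a, b], vector [- b, 0, 0], vector [a, 0, 0]])"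

text \<open>
  The pair \<open>(\<alpha>\<^sub>n, \<beta>\<^sub>n\<^sub>-\<^sub>1)\<close>. For \<open>n = 0\<close> the equation forces \<open>(1, 0)\<close>, in accordance with
  the convention \<open>\<beta>\<^sub>-\<^sub>1 = 0\<close>.
\<close>

definition alpha_beta :: "nat \<Rightarrow> complex poly \<times> complex poly" where
  "alpha_beta n = (THE (\<alpha>, \<beta>). \<forall>v.
     U_incl p_elt ^ n * U_incl (v_k v) =
       U_incl (v_k v) * U_poly \<alpha> (U_incl p_elt) + U_poly \<beta> (U_incl p_elt) * U_incl (v_p v))"

definition alpha_poly :: "nat \<Rightarrow> complex poly" where
  "alpha_poly n = fst (alpha_beta n)"

definition A_num :: "nat \<Rightarrow> complex" where
  "A_num n = fact n * fps_nth (fps_tan 1 + inverse (fps_cos 1)) n"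

text \<open>The argument is the actual (even) index: \<open>E\<^sub>2\<^sub>k\<close> is \<open>E_num (2 * k)\<close>.\<close>

definition E_num :: "nat \<Rightarrow> complex" where
  "E_num m = (-1) ^ (m div 2) * A_num m"

end

theory Submission
  imports Defs
begin

text \<open>
  The operator \<open>ad p\<close> exchanges \<open>v\<^sub>k\<close> and \<open>v\<^sub>p\<close>, so \<open>v\<^sub>k + v\<^sub>p\<close> and \<open>v\<^sub>k - v\<^sub>p\<close> are eigenvectors
  of it with eigenvalues \<open>1\<close> and \<open>-1\<close>, and moving a polynomial in \<open>p\<close> past one of them just
  shifts its argument by \<open>1\<close> or \<open>-1\<close>. Written in terms of these two eigenvectors, the relation
  \<open>p\<^sup>n v\<^sub>k = v\<^sub>k \<alpha>(p) + \<beta>(p) v\<^sub>p\<close> says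
  \<open>\<alpha>(x - 1) + \<beta>(x) = x\<^sup>n\<close> and \<open>\<alpha>(x + 1) - \<beta>(x) = x\<^sup>n\<close>. That these two difference equations
  suffice is a computation in \<open>U\<close> (\<open>difference_equations_imp_commutation\<close>). That they are
  necessary, which is the only place where one must know that \<open>U\<close> is large enough, is shown
  without the Poincare-Birkhoff-Witt theorem: a one-parameter family of four-dimensional
  representations, in which the eigenvalues of \<open>p\<close> run through all complex numbers, already
  detects both equations (\<open>commutation_imp_difference_equations\<close>).

  Eliminating \<open>\<beta>\<close> leaves \<open>\<alpha>(x + 1) + \<alpha>(x - 1) = 2 x\<^sup>n\<close>, that is \<open>cosh(d/dx) \<alpha> = x\<^sup>n\<close>. It has at
  most one polynomial solution, by comparison of leading coefficients
  (\<open>shift_antiperiodic_poly_eq_0\<close>), and that solution is \<open>sech(d/dx) x\<^sup>n\<close>: the Appell polynomials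
  with exponential generating function \<open>sech(t) exp(x t)\<close> satisfy it (\<open>appell_sech_mean\<close>)
  because \<open>sech(t) (exp(t) + exp(-t)) = 2\<close>. Their coefficients are the numbers \<open>E\<^sub>2\<^sub>k\<close>, since
  \<open>sech(t) = sec(\<i>t)\<close>.
\<close>

(* The dollar sign is reserved for vector components: with a second reading, the matrix
   expressions below would have exponentially many parse trees. *)
no_notation fps_nth (infixl \<open>$\<close> 75)

section \<open>Modules over the free algebra\<close>

fun word_act :: "(gl12 \<Rightarrow> complex ^ 'm ^ 'm) \<Rightarrow> gl12 free_word \<Rightarrow> complex ^ 'm \<Rightarrow> complex ^ 'm" where
  "word_act \<rho> (Free_Word Xs) v = foldr (\<lambda>X v. \<rho> X *v v) Xs v"

definition free_act :: "(gl12 \<Rightarrow> complex ^ 'm ^ 'm) \<Rightarrow> free_gl12 \<Rightarrow> complex ^ 'm \<Rightarrow> complex ^ 'm" where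
  "free_act \<rho> f v = (\<Sum>w\<in>Poly_Mapping.keys f. Poly_Mapping.lookup f w *s word_act \<rho> w v)"

lemma word_act_0 [simp]: "word_act \<rho> 0 v = v"
  by (simp add: zero_free_word_def)

lemma word_act_plus: "word_act \<rho> (u + w) v = word_act \<rho> u (word_act \<rho> w v)"
  by (cases u; cases w) simp

lemma word_act_add: "word_act \<rho> w (x + y) = word_act \<rho> w x + word_act \<rho> w y"
proof (cases w)
  case (Free_Word Xs)
  have "foldr (\<lambda>X v. \<rho> X *v v) Xs (x + y)
      = foldr (\<lambda>X v. \<rho> X *v v) Xs x + foldr (\<lambda>X v. \<rho> X *v v) Xs y"
    by (induction Xs) (simp_all add: matrix_vector_right_distrib)
  with Free_Word show ?thesis by simp
qed

lemma word_act_scale: "word_act \<rho> w (c *s x) = c *s word_act \<rho> w x"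
proof (cases w)
  case (Free_Word Xs)
  have "foldr (\<lambda>X v. \<rho> X *v v) Xs (c *s x) = c *s foldr (\<lambda>X v. \<rho> X *v v) Xs x"
    by (induction Xs) (simp_all add: vector_scalar_commute)
  with Free_Word show ?thesis by simp
qed

lemma free_act_0 [simp]: "free_act \<rho> 0 v = 0"
  by (simp add: free_act_def)

lemma free_act_single: "free_act \<rho> (Poly_Mapping.single w c) v = c *s word_act \<rho> w v"
  by (cases "c = 0") (simp_all add: free_act_def)

lemma free_act_plus: "free_act \<rho> (f + g) v = free_act \<rho> f v + free_act \<rho> g v"
  unfolding free_act_def
  by (rule setsum_keys_plus_distrib) (simp_all add: vector_sadd_rdistrib)

lemma free_act_minus: "free_act \<rho> (f - g) v = free_act \<rho> f v - free_act \<rho> g v"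
  using free_act_plus[of \<rho> "f - g" g v] by simp

lemma free_act_right_0 [simp]: "free_act \<rho> f 0 = 0"
  unfolding free_act_def
  using word_act_scale[of \<rho> _ 0 0] by simp

lemma update_eq_single_plus:
  assumes "a \<notin> Poly_Mapping.keys f"
  shows "Poly_Mapping.update a b f = Poly_Mapping.single a b + f"
  using assms
  by (intro poly_mapping_eqI)
     (auto simp: lookup_update lookup_add lookup_single when_def in_keys_iff)

lemma free_act_single_times:
  "free_act \<rho> (Poly_Mapping.single w c * g) v = c *s word_act \<rho> w (free_act \<rho> g v)"
proof (induction g rule: update_induct)
  case const
  then show ?case using word_act_scale[of \<rho> w 0 0] by simp
next
  case (update g u d)
  then show ?case
    by (simp add: update_eq_single_plus distrib_left free_act_plus free_act_single mult_single
        word_act_plus word_act_add word_act_scale vector_add_ldistrib vector_smult_assoc)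
qed

text \<open>
  Concatenation of words becomes composition of operators, hence so does the convolution product,
  by linearity in both factors.
\<close>

lemma free_act_times: "free_act \<rho> (f * g) v = free_act \<rho> f (free_act \<rho> g v)"
proof (induction f rule: update_induct)
  case const
  then show ?case by simp
next
  case (update f u d)
  then show ?case
    by (simp add: update_eq_single_plus distrib_right free_act_plus free_act_single
        free_act_single_times)
qed

section \<open>Homogeneous elements and the superbracket\<close>

lemma gl_homogeneous_iff:
  "gl_homogeneous d X \<longleftrightarrow>
     d = 0 \<and> X $ 1 $ 2 = 0 \<and> X $ 1 $ 3 = 0 \<and> X $ 2 $ 1 = 0 \<and> X $ 3 $ 1 = 0 \<or>
     d = 1 \<and> X $ 1 $ 1 = 0 \<and> X $ 2 $ 2 = 0 \<and> X $ 2 $ 3 = 0 \<and> X $ 3 $ 2 = 0 \<and> X $ 3 $ 3 = 0"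
  by (auto simp: gl_homogeneous_def gl_part_def vec_eq_iff forall_3 index_parity_def)

lemma gl_part_homogeneous:
  assumes "gl_homogeneous d X" "k \<in> {0, 1}"
  shows "gl_part k X = (if k = d then X else 0)"
  using assms by (auto simp: gl_homogeneous_iff gl_part_def vec_eq_iff forall_3 index_parity_def)

lemma superbracket_homogeneous:
  assumes "gl_homogeneous d X" "gl_homogeneous e Y"
  shows "superbracket X Y = X ** Y - gl_scale ((-1) ^ (d * e)) (Y ** X)"
proof -
  have "gl_scale c 0 = 0" for c by (simp add: gl_scale_def vec_eq_iff)
  moreover from assms have "d \<in> {0, 1}" "e \<in> {0, 1}" by (auto simp: gl_homogeneous_def)
  ultimately show ?thesis
    unfolding superbracket_def
    by (auto simp: gl_part_homogeneous[OF assms(1)] gl_part_homogeneous[OF assms(2)])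
qed

section \<open>The oscillator representations\<close>

lemma vector_4:
  fixes a b c d :: "'a :: zero"
  shows "(vector [a, b, c, d] :: 'a ^ 4) $ 1 = a" "(vector [a, b, c, d] :: 'a ^ 4) $ 2 = b"
    "(vector [a, b, c, d] :: 'a ^ 4) $ 3 = c" "(vector [a, b, c, d] :: 'a ^ 4) $ 4 = d"
  unfolding vector_def by simp_all

text \<open>
  The action of \<open>gl(1|2)\<close> by \<open>E\<^sub>1\<^sub>1 = x \<partial>\<^sub>x\<close>, \<open>E\<^sub>1\<^sub>j = x \<partial>\<^sub>j\<close>, \<open>E\<^sub>j\<^sub>1 = \<xi>\<^sub>j \<partial>\<^sub>x\<close>, \<open>E\<^sub>j\<^sub>k = \<xi>\<^sub>j \<partial>\<^sub>k\<close> for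
  \<open>j, k \<in> {2, 3}\<close>, where \<open>x\<close> is an even and \<open>\<xi>\<^sub>2, \<xi>\<^sub>3\<close> are odd (Grassmann) variables, on the space of
  functions of total degree \<open>s\<close>. The basis is
  \<open>x\<^sup>s, x\<^sup>s\<^sup>-\<^sup>1 \<xi>\<^sub>2, x\<^sup>s\<^sup>-\<^sup>1 \<xi>\<^sub>3, x\<^sup>s\<^sup>-\<^sup>2 \<xi>\<^sub>2 \<xi>\<^sub>3\<close>. For an integer \<open>s \<ge> 2\<close> this is the
  supersymmetric power of the natural representation, but the formulas make sense for every
  complex \<open>s\<close>. The degree has to vary because \<open>p\<close> has only finitely many eigenvalues in any one
  of these representations, and twisting by a character would not help: the supertrace of \<open>p\<close>
  is \<open>0\<close>.
\<close>

definition oscillator_rep :: "complex \<Rightarrow> gl12 \<Rightarrow> complex ^ 4 ^ 4" where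
  "oscillator_rep s X = vector
     [vector [s * X $ 1 $ 1, X $ 1 $ 2, X $ 1 $ 3, 0],
      vector [s * X $ 2 $ 1, (s - 1) * X $ 1 $ 1 + X $ 2 $ 2, X $ 2 $ 3, - (X $ 1 $ 3)],
      vector [s * X $ 3 $ 1, X $ 3 $ 2, (s - 1) * X $ 1 $ 1 + X $ 3 $ 3, X $ 1 $ 2],
      vector [0, - (s - 1) * X $ 3 $ 1, (s - 1) * X $ 2 $ 1,
              (s - 2) * X $ 1 $ 1 + X $ 2 $ 2 + X $ 3 $ 3]]"

lemma oscillator_rep_add: "oscillator_rep s (X + Y) = oscillator_rep s X + oscillator_rep s Y"
  by (simp add: vec_eq_iff forall_4 vector_4 oscillator_rep_def algebra_simps)

lemma oscillator_rep_scale: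
  "oscillator_rep s (gl_scale c X) = (\<chi> i j. c * oscillator_rep s X $ i $ j)"
  by (simp add: vec_eq_iff forall_4 vector_4 oscillator_rep_def gl_scale_def algebra_simps)

text \<open>
  The bracket relation is verified on these components, because expanding products of four by four
  matrices would produce much larger terms.
\<close>

lemma oscillator_rep_mult:
  "(oscillator_rep s X *v v) $ 1 = s * X $ 1 $ 1 * v $ 1 + X $ 1 $ 2 * v $ 2 + X $ 1 $ 3 * v $ 3"
  "(oscillator_rep s X *v v) $ 2 = s * X $ 2 $ 1 * v $ 1 + ((s - 1) * X $ 1 $ 1 + X $ 2 $ 2) * v $ 2
      + X $ 2 $ 3 * v $ 3 - X $ 1 $ 3 * v $ 4"
  "(oscillator_rep s X *v v) $ 3 = s * X $ 3 $ 1 * v $ 1 + X $ 3 $ 2 * v $ 2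
      + ((s - 1) * X $ 1 $ 1 + X $ 3 $ 3) * v $ 3 + X $ 1 $ 2 * v $ 4"
  "(oscillator_rep s X *v v) $ 4 = (s - 1) * X $ 2 $ 1 * v $ 3 - (s - 1) * X $ 3 $ 1 * v $ 2
      + ((s - 2) * X $ 1 $ 1 + X $ 2 $ 2 + X $ 3 $ 3) * v $ 4"
  by (simp_all add: oscillator_rep_def matrix_vector_mult_def sum_4 vector_4 algebra_simps)

lemma oscillator_rep_bracket:
  assumes "gl_homogeneous d X" "gl_homogeneous e Y"
  shows "oscillator_rep s (superbracket X Y) *v v =
    oscillator_rep s X *v (oscillator_rep s Y *v v)
      - (-1) ^ (d * e) *s (oscillator_rep s Y *v (oscillator_rep s X *v v))"
proof -
  have entry: "superbracket X Y $ i $ j =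
     (X $ i $ 1 * Y $ 1 $ j + X $ i $ 2 * Y $ 2 $ j + X $ i $ 3 * Y $ 3 $ j)
     - (-1) ^ (d * e) * (Y $ i $ 1 * X $ 1 $ j + Y $ i $ 2 * X $ 2 $ j + Y $ i $ 3 * X $ 3 $ j)"
    for i j
    by (simp add: superbracket_homogeneous[OF assms] matrix_matrix_mult_def sum_3 gl_scale_def)
  from assms show ?thesis
    unfolding gl_homogeneous_iff vec_eq_iff forall_4 oscillator_rep_mult entry
      vector_minus_component vector_smult_component
    by (elim disjE conjE) (simp_all add: algebra_simps)
qed

lemma free_act_enveloping_ideal:
  assumes "f \<in> enveloping_ideal"
  shows "free_act (oscillator_rep s) f v = 0"
  using assms
proof (induction arbitrary: v rule: enveloping_ideal.induct)
  case (rel r)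
  have gen: "free_act (oscillator_rep s) (free_gen X) v = oscillator_rep s X *v v" for X v
    by (simp add: free_gen_def free_act_single)
  have sign: "free_act (oscillator_rep s) ((-1) ^ k * f) v = (-1) ^ k *s free_act (oscillator_rep s) f v"
    for k f v
  proof (cases "even k")
    case True then show ?thesis by simp
  next
    case False then show ?thesis using free_act_minus[of "oscillator_rep s" 0 f v] by simp
  qed
  from rel consider (a) X Y where "r = free_gen (X + Y) - free_gen X - free_gen Y"
    | (b) c X where "r = free_gen (gl_scale c X) - free_scalar c * free_gen X"
    | (c) X Y d e where "gl_homogeneous d X" "gl_homogeneous e Y"
       "r = free_gen X * free_gen Y - (-1) ^ (d * e) * (free_gen Y * free_gen X)
        - free_gen (superbracket X Y)"
    unfolding enveloping_relations_def by blast
  then show ?case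
  proof cases
    case a
    then show ?thesis
      by (simp add: free_act_minus gen oscillator_rep_add matrix_vector_mult_add_rdistrib)
  next
    case b
    then show ?thesis
      by (simp add: free_act_minus free_act_times gen free_scalar_def free_act_single
          oscillator_rep_scale matrix_vector_mult_def vec_eq_iff sum_distrib_left mult.assoc)
  next
    case c
    then show ?thesis
      by (simp add: free_act_minus sign gen oscillator_rep_bracket free_act_times[of _ "free_gen _"])
  qed
qed (simp_all add: free_act_plus free_act_times)

text \<open>
  The enveloping ideal acts by zero, so the free action descends to the enveloping algebra.
\<close>

lift_definition U_act :: "complex \<Rightarrow> U_gl12 \<Rightarrow> complex ^ 4 \<Rightarrow> complex ^ 4"
  is "\<lambda>s. free_act (oscillator_rep s)"
proof
  fix s f g v assume "enveloping_cong f g"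
  then show "free_act (oscillator_rep s) f v = free_act (oscillator_rep s) g v"
    using free_act_enveloping_ideal[of "f - g" s v]
    by (simp add: enveloping_cong_def free_act_minus)
qed

lemma U_act_0 [simp]: "U_act s 0 v = 0"
  by transfer simp

lemma U_act_plus: "U_act s (x + y) v = U_act s x v + U_act s y v"
  by transfer (rule free_act_plus)

lemma U_act_times: "U_act s (x * y) v = U_act s x (U_act s y v)"
  by transfer (rule free_act_times)

lemma U_act_scalar: "U_act s (U_scalar c) v = c *s v"
  by transfer (simp add: free_scalar_def free_act_single)

lemma U_act_incl: "U_act s (U_incl X) v = oscillator_rep s X *v v"
  by transfer (simp add: free_gen_def free_act_single)

section \<open>Evaluation of polynomials in the enveloping algebra\<close>

lemma U_scalar_hom:
  "U_scalar 0 = 0" "U_scalar 1 = 1" "U_scalar (c + d) = U_scalar c + U_scalar d"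
  "U_scalar (c * d) = U_scalar c * U_scalar d"
  by (transfer; simp add: free_scalar_def single_add mult_single
      equivp_reflp[OF equivp_enveloping_cong])+

text \<open>
  Centrality of the scalars is what allows polynomials to be evaluated and moved past other
  elements although \<open>U\<close> is not commutative.
\<close>

lemma U_scalar_commute: "U_scalar c * x = x * U_scalar c"
proof transfer
  fix c and f :: free_gl12
  have "free_scalar c * f = f * free_scalar c"
  proof (induction f rule: update_induct)
    case const
    then show ?case by simp
  next
    case (update f u d)
    then show ?case
      by (simp add: update_eq_single_plus free_scalar_def mult_single algebra_simps)
  qed
  then show "enveloping_cong (free_scalar c * f) (f * free_scalar c)"
    by (simp add: equivp_reflp[OF equivp_enveloping_cong])
qed

lemma U_poly_eq_sum:
  assumes "degree q \<le> N"
  shows "U_poly q x = (\<Sum>i\<le>N. U_scalar (coeff q i) * x ^ i)"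
  unfolding U_poly_def using assms
  by (intro sum.mono_neutral_left) (auto simp: U_scalar_hom coeff_eq_0)

lemma U_poly_pCons: "U_poly (pCons c q) x = U_scalar c + x * U_poly q x"
proof -
  have "U_poly (pCons c q) x = (\<Sum>i\<le>Suc (degree q). U_scalar (coeff (pCons c q) i) * x ^ i)"
    by (rule U_poly_eq_sum) (simp add: degree_pCons_le)
  also have "\<dots> = U_scalar c + (\<Sum>i\<le>degree q. U_scalar (coeff q i) * (x * x ^ i))"
    by (simp add: sum.atMost_Suc_shift del: sum.atMost_Suc)
  also have "(\<Sum>i\<le>degree q. U_scalar (coeff q i) * (x * x ^ i)) = x * U_poly q x"
    by (simp add: U_poly_def sum_distrib_left U_scalar_commute mult.assoc flip: power_Suc)
      (simp add: power_commutes flip: mult.assoc)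
  finally show ?thesis .
qed

lemma U_poly_0 [simp]: "U_poly 0 x = 0"
  by (simp add: U_poly_def U_scalar_hom)

lemma U_poly_add: "U_poly (q + r) x = U_poly q x + U_poly r x"
proof -
  define N where "N = max (degree q) (degree r)"
  have "degree (q + r) \<le> N" "degree q \<le> N" "degree r \<le> N"
    by (auto simp: N_def degree_add_le)
  then show ?thesis
    by (simp add: U_poly_eq_sum[of _ N] U_scalar_hom distrib_right sum.distrib)
qed

lemma U_poly_minus: "U_poly (q - r) x = U_poly q x - U_poly r x"
  using U_poly_add[of "q - r" r x] by (simp add: algebra_simps)

lemma U_poly_monom: "U_poly (monom 1 n) x = x ^ n"
  by (induction n) (simp_all add: monom_0 monom_Suc U_poly_pCons U_scalar_hom)

lemma U_poly_smult: "U_poly (smult c q) x = U_scalar c * U_poly q x"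
  by (induction q) (simp_all add: U_poly_pCons U_scalar_hom algebra_simps, 
     metis U_scalar_commute mult.assoc)

lemma U_poly_shift: "U_poly (q \<circ>\<^sub>p [:c, 1:]) x = U_poly q (x + U_scalar c)"
  by (induction q)
    (simp_all add: pcompose_pCons U_poly_pCons U_poly_add U_poly_smult U_scalar_hom
      algebra_simps)

text \<open>
  For \<open>x = p\<close>, an eigenvector \<open>w\<close> of \<open>ad p\<close> and \<open>y\<close> the corresponding shift of \<open>p\<close>, this moves all
  polynomials in \<open>p\<close> past \<open>w\<close>.
\<close>

lemma U_poly_intertwine:
  assumes "x * w = w * y"
  shows "U_poly q x * w = w * U_poly q y"
proof (induction q)
  case (pCons c q)
  have "U_poly (pCons c q) x * w = U_scalar c * w + x * (U_poly q x * w)"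
    by (simp add: U_poly_pCons algebra_simps)
  also have "\<dots> = w * U_scalar c + (x * w) * U_poly q y"
    by (simp add: U_scalar_commute pCons.IH mult.assoc)
  also have "\<dots> = w * U_poly (pCons c q) y"
    by (simp add: assms U_poly_pCons algebra_simps)
  finally show ?case .
qed simp

section \<open>Commutation relations as difference equations\<close>

lemma gl_homogeneous_p: "gl_homogeneous 0 p_elt"
  by (simp add: gl_homogeneous_iff p_elt_def)

lemma gl_homogeneous_v:
  "gl_homogeneous 1 (v_k v)" "gl_homogeneous 1 (v_p v)"
  by (cases v; simp add: gl_homogeneous_iff v_k_def v_p_def)+

lemma U_incl_even_commutator:
  assumes "gl_homogeneous 0 X" "gl_homogeneous e Y"
  shows "U_incl X * U_incl Y = U_incl Y * U_incl X + U_incl (superbracket X Y)"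
  using assms
proof transfer
  fix X Y e assume *: "gl_homogeneous 0 X" "gl_homogeneous e Y"
  have "free_gen X * free_gen Y - (-1) ^ (0 * e) * (free_gen Y * free_gen X)
        - free_gen (superbracket X Y) \<in> enveloping_ideal"
    by (rule enveloping_ideal.rel) (use * in \<open>unfold enveloping_relations_def, blast\<close>)
  then show "enveloping_cong (free_gen X * free_gen Y)
      (free_gen Y * free_gen X + free_gen (superbracket X Y))"
    by (simp add: enveloping_cong_def algebra_simps)
qed

lemma p_bracket_v:
  "superbracket p_elt (v_k v) = v_p v" "superbracket p_elt (v_p v) = v_k v"
  unfolding superbracket_homogeneous[OF gl_homogeneous_p gl_homogeneous_v(1)]
    superbracket_homogeneous[OF gl_homogeneous_p gl_homogeneous_v(2)]
  by (simp_all add: vec_eq_iff forall_3 p_elt_def v_k_def v_p_def matrix_matrix_mult_def sum_3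
      gl_scale_def split: prod.split)

text \<open>
  The element \<open>p\<close> is diagonal: each \<open>x\<close> contributes \<open>2\<close> and each \<open>\<xi>\<^sub>j\<close> contributes \<open>1\<close> to the
  eigenvalue of a basis monomial.
\<close>

lemma U_act_poly_p:
  "U_act s (U_poly q (U_incl p_elt)) x $ i
     = poly q (vector [2 * s, 2 * s - 1, 2 * s - 1, 2 * s - 2] $ i) * x $ i"
proof (induction q)
  case (pCons c q)
  have p: "(oscillator_rep s p_elt *v y) $ i
      = vector [2 * s, 2 * s - 1, 2 * s - 1, 2 * s - 2] $ i * y $ i" for y
  proof -
    have "\<forall>i. (oscillator_rep s p_elt *v y) $ i
      = vector [2 * s, 2 * s - 1, 2 * s - 1, 2 * s - 2] $ i * y $ i"
      unfolding forall_4 oscillator_rep_mult vector_4 by (simp add: p_elt_def algebra_simps)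
    then show ?thesis ..
  qed
  show ?case
    by (simp add: U_poly_pCons U_act_plus U_act_times U_act_scalar U_act_incl p pCons.IH
        algebra_simps)
qed simp

text \<open>
  Both sides are compared at single matrix entries of the oscillator representations, for
  \<open>v = (1, 0)\<close>. Here \<open>v\<^sub>k = E\<^sub>1\<^sub>2 + E\<^sub>3\<^sub>1\<close> and \<open>v\<^sub>p = E\<^sub>1\<^sub>2 - E\<^sub>3\<^sub>1\<close>: an entry of \<open>E\<^sub>1\<^sub>2\<close>, which raises the
  eigenvalue of \<open>p\<close> by \<open>1\<close>, gives the first equation, and an entry of \<open>E\<^sub>3\<^sub>1\<close>, which lowers it by
  \<open>1\<close>, gives the second one.
\<close>

lemma commutation_imp_difference_equations:
  assumes "\<And>v. U_incl p_elt ^ n * U_incl (v_k v) =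
    U_incl (v_k v) * U_poly \<alpha> (U_incl p_elt) + U_poly \<beta> (U_incl p_elt) * U_incl (v_p v)"
  shows "poly \<alpha> (x - 1) + poly \<beta> x = x ^ n" and "poly \<alpha> (x + 1) - poly \<beta> x = x ^ n"
proof -
  let ?p = "U_poly (monom 1 n) (U_incl p_elt)"
  have act: "U_act s ?p (oscillator_rep s (v_k (1, 0)) *v y) $ i =
     (oscillator_rep s (v_k (1, 0)) *v U_act s (U_poly \<alpha> (U_incl p_elt)) y) $ i +
     U_act s (U_poly \<beta> (U_incl p_elt)) (oscillator_rep s (v_p (1, 0)) *v y) $ i" for s y i
    using arg_cong[OF assms[of "(1, 0)"], of "\<lambda>u. U_act s u y $ i"]
    by (simp add: U_poly_monom U_act_plus U_act_times U_act_incl)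
  note simps = U_act_poly_p vector_4 oscillator_rep_mult v_k_def v_p_def poly_monom axis_def
  \<comment> \<open>The entry from \<open>x\<^sup>s\<^sup>-\<^sup>1 \<xi>\<^sub>2\<close> to \<open>x\<^sup>s\<close>; its target has eigenvalue \<open>2 s\<close>.\<close>
  show "poly \<alpha> (x - 1) + poly \<beta> x = x ^ n"
    using act[of "x / 2" "axis 2 1" 1] by (simp add: simps)
  show "poly \<alpha> (x + 1) - poly \<beta> x = x ^ n"
  \<comment> \<open>The entry of \<open>E\<^sub>3\<^sub>1\<close> from \<open>x\<^sup>s\<close> to \<open>x\<^sup>s\<^sup>-\<^sup>1 \<xi>\<^sub>3\<close> is \<open>s\<close> and vanishes for \<open>s = 0\<close>, that is at
    \<open>x = 2 s - 1 = -1\<close>. There the entry from \<open>x\<^sup>s\<^sup>-\<^sup>1 \<xi>\<^sub>2\<close> to \<open>x\<^sup>s\<^sup>-\<^sup>2 \<xi>\<^sub>2 \<xi>\<^sub>3\<close> serves instead, with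
    \<open>x = 2 s - 2\<close>.\<close>
  proof (cases "x = -1")
    case False
    define c where "c = (x + 1) / 2"
    have x: "x = 2 * c - 1" and "c \<noteq> 0"
      using False by (simp_all add: c_def field_simps) (metis add.commute add_eq_0_iff)
    have "c * (poly \<alpha> (x + 1) - poly \<beta> x) = c * x ^ n"
      using act[of c "axis 1 1" 3] by (simp add: simps x algebra_simps)
    with \<open>c \<noteq> 0\<close> show ?thesis by simp
  next
    case True
    show ?thesis
      using act[of "1 / 2" "axis 2 1" 4] by (simp add: simps True)
  qed
qed

text \<open>
  In terms of the eigenvectors \<open>v\<^sub>k + v\<^sub>p\<close> and \<open>v\<^sub>k - v\<^sub>p\<close> of \<open>ad p\<close>, the assumptions become
  \<open>(x + 1)\<^sup>n = \<alpha>(x) + \<beta>(x + 1)\<close> and \<open>(x - 1)\<^sup>n = \<alpha>(x) - \<beta>(x - 1)\<close>, which are the coefficients of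
  the two eigenvectors after all powers of \<open>p\<close> have been moved to the right.
\<close>

lemma difference_equations_imp_commutation:
  assumes "\<And>x. poly \<alpha> (x - 1) + poly \<beta> x = x ^ n"
    and "\<And>x. poly \<alpha> (x + 1) - poly \<beta> x = x ^ n"
  shows "U_incl p_elt ^ n * U_incl (v_k v) =
    U_incl (v_k v) * U_poly \<alpha> (U_incl p_elt) + U_poly \<beta> (U_incl p_elt) * U_incl (v_p v)"
proof -
  define P K V where "P = U_incl p_elt" and "K = U_incl (v_k v)" and "V = U_incl (v_p v)"
  have PK: "P * K = K * P + V" and PV: "P * V = V * P + K"
    unfolding P_def K_def V_def
    using U_incl_even_commutator[OF gl_homogeneous_p gl_homogeneous_v(1)]
      U_incl_even_commutator[OF gl_homogeneous_p gl_homogeneous_v(2)] by (simp_all add: p_bracket_v)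
  have minus_1: "U_scalar (-1) = -1"
    using U_scalar_hom(1-2) U_scalar_hom(3)[of "-1" 1] by (simp add: eq_neg_iff_add_eq_0)
  have up: "P * (K + V) = (K + V) * (P + U_scalar 1)"
    and down: "P * (K - V) = (K - V) * (P + U_scalar (-1))"
    by (simp_all add: PK PV algebra_simps U_scalar_hom minus_1)
  have up': "U_poly q P * (K + V) = (K + V) * U_poly (q \<circ>\<^sub>p [:1, 1:]) P"
    and down': "U_poly q P * (K - V) = (K - V) * U_poly (q \<circ>\<^sub>p [:-1, 1:]) P" for q
    by (simp_all only: U_poly_shift U_poly_intertwine[OF up] U_poly_intertwine[OF down])
  have shift_up: "monom 1 n \<circ>\<^sub>p [:1, 1:] = \<alpha> + \<beta> \<circ>\<^sub>p [:1, 1:]"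
  proof (rule poly_ext)
    fix x
    show "poly (monom 1 n \<circ>\<^sub>p [:1, 1:]) x = poly (\<alpha> + \<beta> \<circ>\<^sub>p [:1, 1:]) x"
      using assms(1)[of "x + 1"] by (simp add: poly_pcompose poly_monom add.commute)
  qed
  have shift_down: "monom 1 n \<circ>\<^sub>p [:-1, 1:] = \<alpha> - \<beta> \<circ>\<^sub>p [:-1, 1:]"
  proof (rule poly_ext)
    fix x
    show "poly (monom 1 n \<circ>\<^sub>p [:-1, 1:]) x = poly (\<alpha> - \<beta> \<circ>\<^sub>p [:-1, 1:]) x"
      using assms(2)[of "x - 1"] by (simp add: poly_pcompose poly_monom)
  qed
  have "2 * (P ^ n * K) = U_poly (monom 1 n) P * (K + V) + U_poly (monom 1 n) P * (K - V)"
    by (simp add: U_poly_monom mult_2 algebra_simps)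
  also have "\<dots> = (K + V) * U_poly \<alpha> P + (K - V) * U_poly \<alpha> P
      + ((K + V) * U_poly (\<beta> \<circ>\<^sub>p [:1, 1:]) P - (K - V) * U_poly (\<beta> \<circ>\<^sub>p [:-1, 1:]) P)"
    unfolding up' down' shift_up shift_down U_poly_add U_poly_minus by (simp add: algebra_simps)
  also have "\<dots> = 2 * (K * U_poly \<alpha> P + U_poly \<beta> P * V)"
    unfolding up'[symmetric] down'[symmetric] by (simp add: mult_2 algebra_simps)
  finally have "U_scalar (1/2) * (2 * (P ^ n * K))
      = U_scalar (1/2) * (2 * (K * U_poly \<alpha> P + U_poly \<beta> P * V))"
    by simp
  moreover have "U_scalar (1/2) * (2 * u) = u" for u
  proof -
    have "U_scalar (1/2) * (2 * u) = (U_scalar (1/2) + U_scalar (1/2)) * u"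
      by (simp add: mult_2 distrib_left distrib_right)
    also have "\<dots> = u" by (simp add: U_scalar_hom(2) flip: U_scalar_hom(3))
    finally show ?thesis .
  qed
  ultimately show ?thesis by (simp only: P_def K_def V_def)
qed

section \<open>The hyperbolic secant and its Appell polynomials\<close>

lemma fps_nth_compose_uminus_X:
  "fps_nth (f oo - fps_X) n = (-1) ^ n * fps_nth (f :: complex fps) n"
  using fps_nth_compose_linear[of f "-1" n] by (simp flip: fps_const_neg)

text \<open>
  The tangent is odd and the secant is even, so the even-indexed numbers \<open>A\<^sub>2\<^sub>k\<close> come from the
  secant alone.
\<close>

lemma even_fps_tan: "even n \<Longrightarrow> fps_nth (fps_tan (1 :: complex)) n = 0"
proof -
  assume "even n"
  have [simp]: "fps_cos (1::complex) oo - fps_X = fps_cos 1"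
    by (intro fps_ext) (simp add: fps_nth_compose_uminus_X fps_cos_def)
  have [simp]: "fps_sin (1::complex) oo - fps_X = - fps_sin 1"
    by (intro fps_ext) (simp add: fps_nth_compose_uminus_X fps_sin_def)
  have "fps_tan (1 :: complex) oo - fps_X = - fps_tan 1"
    unfolding fps_tan_def
    by (subst fps_divide_compose) (simp_all add: fps_divide_unit)
  then have "fps_nth (fps_tan (1 :: complex) oo - fps_X) n = - fps_nth (fps_tan 1) n"
    by simp
  with \<open>even n\<close> show ?thesis by (simp add: fps_nth_compose_uminus_X)
qed

lemma odd_fps_sec: "odd n \<Longrightarrow> fps_nth (inverse (fps_cos (1 :: complex))) n = 0"
proof -
  assume "odd n"
  have "fps_cos (1::complex) oo - fps_X = fps_cos 1"
    by (intro fps_ext) (simp add: fps_nth_compose_uminus_X fps_cos_def)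
  then have "inverse (fps_cos (1 :: complex)) oo - fps_X = inverse (fps_cos 1)"
    by (simp add: fps_inverse_compose)
  then have "fps_nth (inverse (fps_cos (1 :: complex)) oo - fps_X) n = fps_nth (inverse (fps_cos 1)) n"
    by simp
  with \<open>odd n\<close> show ?thesis by (simp add: fps_nth_compose_uminus_X)
qed

definition fps_sech :: "complex fps" where
  "fps_sech = inverse (fps_cos \<i>)"

text \<open>
  The substitution \<open>sech(t) = sec(\<i>t)\<close> turns the factor \<open>\<i>\<^sup>2\<^sup>k\<close> into the sign in the definition of
  \<open>E\<^sub>2\<^sub>k\<close>.
\<close>

lemma fps_nth_sech: "fps_nth fps_sech n = (if even n then E_num n / fact n else 0)"
proof -
  have "fps_cos (1::complex) oo (fps_const \<i> * fps_X) = fps_cos \<i>"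
    by (intro fps_ext) (simp add: fps_cos_def)
  then have "fps_sech = inverse (fps_cos 1) oo (fps_const \<i> * fps_X)"
    by (simp add: fps_sech_def fps_inverse_compose)
  then have "fps_nth fps_sech n = fps_nth (inverse (fps_cos 1) oo (fps_const \<i> * fps_X)) n"
    by (rule arg_cong)
  also have "\<dots> = \<i> ^ n * fps_nth (inverse (fps_cos 1)) n"
    by (rule fps_nth_compose_linear)
  finally have "fps_nth fps_sech n = \<i> ^ n * fps_nth (inverse (fps_cos 1)) n" .
  then show ?thesis
    by (auto simp: odd_fps_sec E_num_def A_num_def even_fps_tan elim!: evenE)
qed

lemma fps_sech_times_exp: "fps_sech * (fps_exp 1 + fps_exp (-1)) = 2"
proof -
  have "fps_exp 1 + fps_exp (-1) = 2 * fps_cos \<i>"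
    by (simp add: fps_cos_fps_exp_ii fps_divide_unit fps_const_inverse numeral_fps_const algebra_simps)
  then show ?thesis
    using inverse_mult_eq_1[of "fps_cos \<i>"] by (simp add: fps_sech_def mult.left_commute)
qed

definition appell_sech :: "nat \<Rightarrow> complex poly" where
  "appell_sech n = (\<Sum>k = 0..n div 2. monom (E_num (2 * k) * of_nat (n choose (2 * k))) (n - 2 * k))"

text \<open>
  The exponential generating function \<open>sech(t) exp(x t)\<close>, read off coefficientwise.
\<close>

lemma poly_appell_sech:
  "poly (appell_sech n) x = fact n * fps_nth (fps_sech * fps_exp x) n"
proof -
  have "fact n * fps_nth (fps_sech * fps_exp x) n =
     (\<Sum>i = 0..n. if even i then E_num i * of_nat (n choose i) * x ^ (n - i) else 0)"
    unfolding fps_mult_nth sum_distrib_left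
    by (intro sum.cong) (auto simp: fps_nth_sech binomial_fact field_simps)
  also have "\<dots> = (\<Sum>i\<in>(*) 2 ` {0..n div 2}. E_num i * of_nat (n choose i) * x ^ (n - i))"
    by (rule sum.mono_neutral_cong_right) (auto elim!: evenE)
  also have "\<dots> = poly (appell_sech n) x"
    by (simp add: appell_sech_def sum.reindex inj_on_def poly_sum poly_monom)
  finally show ?thesis ..
qed

text \<open>
  Shifting \<open>x\<close> by \<open>\<plusminus>1\<close> multiplies the generating function by \<open>exp(\<plusminus>t)\<close>, and the two factors add up
  to \<open>2 cosh(t)\<close>, which cancels \<open>sech(t)\<close>.
\<close>

lemma appell_sech_mean:
  "poly (appell_sech n) (x + 1) + poly (appell_sech n) (x - 1) = 2 * x ^ n"
proof -
  have "fps_sech * fps_exp (x + 1) + fps_sech * fps_exp (x - 1)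
      = fps_exp x * (fps_sech * (fps_exp 1 + fps_exp (-1)))"
    using fps_exp_add_mult[of x "-1"] by (simp add: fps_exp_add_mult algebra_simps)
  also have "\<dots> = fps_const 2 * fps_exp x" by (simp add: fps_sech_times_exp numeral_fps_const)
  finally have "fps_nth (fps_sech * fps_exp (x + 1)) n + fps_nth (fps_sech * fps_exp (x - 1)) n
      = 2 * (x ^ n / fact n)"
    by (metis fps_add_nth fps_exp_nth fps_mult_left_const_nth of_nat_fact)
  then show ?thesis by (simp add: poly_appell_sech flip: distrib_left)
qed

section \<open>Uniqueness and conclusion\<close>

text \<open>
  A shift of the argument preserves the leading coefficient, whereas the assumption says that
  the shift by \<open>2\<close> negates the polynomial.
\<close>

lemma shift_antiperiodic_poly_eq_0:
  fixes q :: "complex poly"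
  assumes "\<And>x. poly q (x + 1) + poly q (x - 1) = 0"
  shows "q = 0"
proof -
  have "q \<circ>\<^sub>p [:2, 1:] = - q"
  proof (rule poly_ext)
    fix x
    show "poly (q \<circ>\<^sub>p [:2, 1:]) x = poly (- q) x"
      using assms[of "x + 1"] by (simp add: poly_pcompose add.commute eq_neg_iff_add_eq_0)
  qed
  then have "lead_coeff (q \<circ>\<^sub>p [:2, 1:]) = - lead_coeff q" by simp
  moreover have "lead_coeff (q \<circ>\<^sub>p [:2, 1:]) = lead_coeff q"
    by (subst lead_coeff_comp) simp_all
  ultimately have "lead_coeff q = 0" by simp
  then show ?thesis by simp
qed

theorem proposition4p4:
  fixes n :: nat
  assumes "n \<ge> 1"
  shows "alpha_poly n =
    (\<Sum>k = 0..n div 2. monom (E_num (2 * k) * of_nat (n choose (2 * k))) (n - 2 * k))"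
proof -
  \<comment> \<open>The first difference equation forces this choice of \<open>\<beta>\<close> once \<open>\<alpha>\<close> is known.\<close>
  define \<beta> where "\<beta> = monom 1 n - appell_sech n \<circ>\<^sub>p [:-1, 1:]"
  have \<beta>: "poly \<beta> x = x ^ n - poly (appell_sech n) (x - 1)" for x
    by (simp add: \<beta>_def poly_monom poly_pcompose)
  have "alpha_beta n = (appell_sech n, \<beta>)"
    unfolding alpha_beta_def
  proof (rule the_equality, safe)
    fix v
    show "U_incl p_elt ^ n * U_incl (v_k v) =
        U_incl (v_k v) * U_poly (appell_sech n) (U_incl p_elt) + U_poly \<beta> (U_incl p_elt) * U_incl (v_p v)"
    proof (rule difference_equations_imp_commutation)
      fix x
      show "poly (appell_sech n) (x - 1) + poly \<beta> x = x ^ n" by (simp add: \<beta>)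
      show "poly (appell_sech n) (x + 1) - poly \<beta> x = x ^ n"
        using appell_sech_mean[of n x] by (simp add: \<beta> algebra_simps)
    qed
  next
    fix \<alpha>' \<beta>'
    assume "\<forall>v. U_incl p_elt ^ n * U_incl (v_k v) =
        U_incl (v_k v) * U_poly \<alpha>' (U_incl p_elt) + U_poly \<beta>' (U_incl p_elt) * U_incl (v_p v)"
    then have *: "poly \<alpha>' (x - 1) + poly \<beta>' x = x ^ n" "poly \<alpha>' (x + 1) - poly \<beta>' x = x ^ n" for x
      using commutation_imp_difference_equations by blast+
    have "\<alpha>' - appell_sech n = 0"
    proof (rule shift_antiperiodic_poly_eq_0)
      fix x
      have "poly \<alpha>' (x + 1) + poly \<alpha>' (x - 1) = 2 * x ^ n"
        using *[of x] by (simp add: algebra_simps)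
      then show "poly (\<alpha>' - appell_sech n) (x + 1) + poly (\<alpha>' - appell_sech n) (x - 1) = 0"
        using appell_sech_mean[of n x] by (simp add: algebra_simps)
    qed
    then show \<alpha>': "\<alpha>' = appell_sech n" by simp
    show "\<beta>' = \<beta>"
    proof (rule poly_ext)
      fix x
      show "poly \<beta>' x = poly \<beta> x"
        using *(1)[of x] by (simp add: \<beta> \<alpha>' eq_diff_eq add.commute)
    qed
  qed
  then show ?thesis by (simp add: alpha_poly_def appell_sech_def)
qed

end
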